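(* An infinite word is a standard Sturmian word if and only if it is a limit of the reversals of solutions $w$ such that $\gcd(|w|,|w|_1)=1$.
   Context: Words are over $\{0,1\}$; $|w|$ is the length of $w$ and $|w|_1$ the number of occurrences of the letter $1$ in $w$. The reversal of a word is the word read from right to left. An infinite word is a map $\mathbb N\to\{0,1\}$. An infinite word $\mathbf w$ is a limit of a sequence $(v_n)$ of finite words if $|v_n|\to\infty$ and for every $m$ the prefix of length $m$ of $v_n$ equals the prefix of length $m$ of $\mathbf w$ for all large $n$. Standard words: for a sequence $(d_k)_{k\ge1}$ of positive integers put $s_{-1}=1$, $s_0=0$, $s_1=s_0^{d_1-1}s_{-1}$, and $s_k=s_{k-1}^{d_k}s_{k-2}$ for $k\ge2$. The words $s_k$ obtained in this manner (over all sequences $(d_k)$) are the standard words. A standard Sturmian word is a limit of a sequence of standard words; in particular, the limit of the sequence $(s_k)$ associated with any $(d_k)$ is a standard Sturmian word. Solutions: for integers $\mathfrak a\ge1$, $\mathfrak b\ge0$ let $S_1=0$, $S_2=010^{\mathfrak a-1}$, $S_3=010^{\mathfrak a}$, $S_4=10^{\mathfrak a}$, $S_5=10^{\mathfrak a+1}(10^{\mathfrak a})^{\mathfrak b}$, $S_6=10^{\mathfrak a+1}(10^{\mathfrak a})^{\mathfrak b+1}$. Let $\mathcal L(\mathfrak a,\mathfrak b)$ be the set of all finite factors of infinite concatenations of the words $S_5$ and $S_6$. Let $\Pi(\mathfrak a,\mathfrak b)$ be the set of nonempty words in $\mathcal L(\mathfrak a,\mathfrak b)$ that are products $X_1^2\cdots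 X_n^2$ with all $X_i\in\{S_1,\dots,S_6\}$. A nonempty word $v$ is a solution with parameters $(\mathfrak a,\mathfrak b)$ if $v^2\in\Pi(\mathfrak a,\mathfrak b)$ and $v$ can be written as $v=X_1\cdots X_n$ with $X_i\in\{S_1,\dots,S_6\}$ such that $X_1^2\cdots X_n^2=(X_1\cdots X_n)^2$. Convention: a word $v$ is called a solution if, for some integers $\mathfrak a\ge1$, $\mathfrak b\ge0$, either $v$ or the word obtained from $v$ by exchanging the letters $0$ and $1$ is a solution with parameters $(\mathfrak a,\mathfrak b)$. *)

theory Defs
  imports Main
begin

text \<open>The letter 0 is \<^const>\<open>False\<close> and the letter 1 is \<^const>\<open>True\<close>.\<close>

type_synonym word = "bool list"
type_synonym infword = "nat \<Rightarrow> bool"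

abbreviation ltr0 :: bool where "ltr0 \<equiv> False"
abbreviation ltr1 :: bool where "ltr1 \<equiv> True"

definition wpow :: "word \<Rightarrow> nat \<Rightarrow> word" where
  "wpow u n = concat (replicate n u)"

definition word_limit :: "(nat \<Rightarrow> word) \<Rightarrow> infword \<Rightarrow> bool" where
  "word_limit v x \<longleftrightarrow>
     filterlim (\<lambda>n. length (v n)) at_top sequentially \<and>
     (\<forall>m. eventually (\<lambda>n. take m (v n) = map x [0..<m]) sequentially)"


text \<open>
  The index is shifted by one, so that \<open>std_seq d (Suc k)\<close> is $s_k$ and \<open>std_seq d 0\<close> is $s_{-1}$.
  Only the values \<open>d k\<close> with \<open>k \<ge> 1\<close> are used.
\<close>

fun std_seq :: "(nat \<Rightarrow> nat) \<Rightarrow> nat \<Rightarrow> word" where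
  "std_seq d 0 = [ltr1]"
| "std_seq d (Suc 0) = [ltr0]"
| "std_seq d (Suc (Suc 0)) = wpow (std_seq d (Suc 0)) (d 1 - 1) @ std_seq d 0"
| "std_seq d (Suc (Suc (Suc k))) =
     wpow (std_seq d (Suc (Suc k))) (d (Suc (Suc k))) @ std_seq d (Suc k)"

definition standard_word :: "word \<Rightarrow> bool" where
  "standard_word u \<longleftrightarrow> (\<exists>d k. (\<forall>i\<ge>1. d i \<ge> 1) \<and> u = std_seq d k)"

text \<open>
  The words \<open>v n\<close> may come from different sequences \<open>d\<close>, so that some periodic infinite words
  are included.
\<close>

definition standard_sturmian :: "infword \<Rightarrow> bool" where
  "standard_sturmian x \<longleftrightarrow> (\<exists>v. (\<forall>n. standard_word (v n)) \<and> word_limit v x)"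


definition S1 :: word where
  "S1 = [ltr0]"

definition S2 :: "nat \<Rightarrow> word" where
  "S2 a = [ltr0, ltr1] @ wpow [ltr0] (a - 1)"

definition S3 :: "nat \<Rightarrow> word" where
  "S3 a = [ltr0, ltr1] @ wpow [ltr0] a"

definition S4 :: "nat \<Rightarrow> word" where
  "S4 a = [ltr1] @ wpow [ltr0] a"

definition S5 :: "nat \<Rightarrow> nat \<Rightarrow> word" where
  "S5 a b = [ltr1] @ wpow [ltr0] (a + 1) @ wpow ([ltr1] @ wpow [ltr0] a) b"

definition S6 :: "nat \<Rightarrow> nat \<Rightarrow> word" where
  "S6 a b = [ltr1] @ wpow [ltr0] (a + 1) @ wpow ([ltr1] @ wpow [ltr0] a) (b + 1)"

definition S_words :: "nat \<Rightarrow> nat \<Rightarrow> word set" where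
  "S_words a b = {S1, S2 a, S3 a, S4 a, S5 a b, S6 a b}"

definition inf_concat :: "(nat \<Rightarrow> word) \<Rightarrow> infword \<Rightarrow> bool" where
  "inf_concat f x \<longleftrightarrow>
     (\<forall>n. let c = concat (map f [0..<n]) in map x [0..<length c] = c)"

definition lang :: "nat \<Rightarrow> nat \<Rightarrow> word set" where
  "lang a b = {u. \<exists>f x i. (\<forall>n. f n \<in> {S5 a b, S6 a b}) \<and> inf_concat f x \<and>
                    u = map x [i..<i + length u]}"

definition square_products :: "nat \<Rightarrow> nat \<Rightarrow> word set" where
  "square_products a b =
     {u \<in> lang a b. u \<noteq> [] \<and>
        (\<exists>Xs. set Xs \<subseteq> S_words a b \<and> u = concat (map (\<lambda>X. X @ X) Xs))}"

definition solution_with :: "nat \<Rightarrow> nat \<Rightarrow> word \<Rightarrow> bool" where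
  "solution_with a b v \<longleftrightarrow>
     v \<noteq> [] \<and> v @ v \<in> square_products a b \<and>
     (\<exists>Xs. set Xs \<subseteq> S_words a b \<and> v = concat Xs \<and>
        concat (map (\<lambda>X. X @ X) Xs) = concat Xs @ concat Xs)"

definition solution :: "word \<Rightarrow> bool" where
  "solution v \<longleftrightarrow>
     (\<exists>a b. a \<ge> 1 \<and> (solution_with a b v \<or> solution_with a b (map Not v)))"

end

(*
  Reversed standard words are generated from 0 by exchanging the letters and by the substitution
  phi: 0 -> 0, 1 -> 10. Both operations preserve solutions: phi maps the words S_i of parameters
  (a, b) to those of (a + 1, b), while phi after the exchange maps each S_i of parameters (a, b) to
  a word of parameters (1, a - 1) whose square is again a product of squares of the S_i with the
  right roots.

  Conversely, let v be a solution, N = |v| and p = |v|_1, and plot v as a path with height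
  N |w|_1 - p |w| over each prefix w. The equation X_1^2 ... X_n^2 = (X_1 ... X_n)^2 says that at a
  cut between factors the height at twice the position is doubled. So an extremum of the path must
  lie inside a single factor, and the shape of the S_i forces all heights into [-p, N - p]. If N and
  p are coprime, only two words of length N with p ones have this property, one for each first
  letter, and both are reversed standard words.
*)

theory Submission
  imports Defs "HOL-Library.Sublist"
begin

section \<open>Powers of words, letter counts and the substitution \<open>phi\<close>\<close>

lemma wpow_0 [simp]: "wpow u 0 = []"
  by (simp add: wpow_def)

lemma wpow_Suc [simp]: "wpow u (Suc n) = u @ wpow u n"
  by (simp add: wpow_def)

lemma wpow_add: "wpow u (m + n) = wpow u m @ wpow u n"
  by (induction m) auto

lemma wpow_shift: "u @ wpow (v @ u) n = wpow (u @ v) n @ u"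
  by (induction n) auto

lemma wpow_commute: "wpow u n @ u = u @ wpow u n"
  using wpow_shift[of u "[]" n] by simp

lemma wpow_commute_append: "wpow u n @ u @ v = u @ wpow u n @ v"
  using wpow_commute[of u n] by (metis append_assoc)

lemma wpow_eq_replicate: "wpow [c] n = replicate n c"
  by (induction n) auto

lemma map_wpow: "map f (wpow u n) = wpow (map f u) n"
  by (induction n) auto

lemma rev_wpow: "rev (wpow u n) = wpow (rev u) n"
  by (induction n) (auto simp: wpow_commute)

lemma count_list_le_length: "count_list w c \<le> length w"
  by (induction w) auto

lemma count_list_map_Not: "count_list (map Not w) c = length w - count_list w c"
proof (induction w)
  case (Cons x w)
  then show ?case using count_list_le_length[of w c] by auto
qed simp

definition phi :: "word \<Rightarrow> word" where
  "phi w = concat (map (\<lambda>c. if c then [ltr1, ltr0] else [ltr0]) w)"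

lemma phi_simps [simp]:
  "phi [] = []" "phi (c # w) = (if c then [ltr1, ltr0] else [ltr0]) @ phi w"
  by (simp_all add: phi_def)

lemma phi_append [simp]: "phi (u @ v) = phi u @ phi v"
  by (simp add: phi_def)

lemma phi_wpow: "phi (wpow u n) = wpow (phi u) n"
  by (induction n) auto

lemma count_list_phi [simp]: "count_list (phi w) ltr1 = count_list w ltr1"
  by (induction w) auto

lemma length_phi [simp]: "length (phi w) = length w + count_list w ltr1"
  by (induction w) auto

text \<open>These turn out to be exactly the reversals of standard words
  (\<open>standard_word_iff_rev_std\<close>). The two generators replace the sequences
  \<open>d\<close> by a structural induction.\<close>

inductive rev_std :: "word \<Rightarrow> bool" where
  zero: "rev_std [ltr0]"
| map_Not: "rev_std w \<Longrightarrow> rev_std (map Not w)"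
| phi: "rev_std w \<Longrightarrow> rev_std (phi w)"

lemma rev_std_one: "rev_std [ltr1]"
  using rev_std.map_Not[OF rev_std.zero] by simp


subsection \<open>Standard words\<close>

text \<open>Reversal turns the substitution \<open>0 \<mapsto> 0, 1 \<mapsto> 01\<close>, which increments \<open>d 1\<close>, into \<^const>\<open>phi\<close>.\<close>

lemma std_seq_phi:
  assumes "d 1 \<ge> 1" "d' 1 = Suc (d 1)" "\<And>i. i \<ge> 2 \<Longrightarrow> d' i = d i" "k \<ge> 1"
  shows "rev (std_seq d' k) = phi (rev (std_seq d k))"
  using assms
proof (induction d k rule: std_seq.induct)
  case (3 d)
  then obtain m where "d 1 = Suc m" by (metis Suc_le_D One_nat_def)
  then show ?case using 3
    using wpow_commute[of "[ltr0]" m] by (simp add: rev_wpow phi_wpow)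
next
  case (4 d k)
  then show ?case
    by (simp add: rev_wpow phi_wpow)
qed auto

text \<open>For \<open>d 1 = 1\<close> the words $s_0, s_1$ are 0, 1. Exchanging letters gives the
  initial pair 1, 0, so the recursion restarts one index later. The new first exponent is
  \<open>d' 1 - 1\<close>, which must equal \<open>d 2\<close>.\<close>

lemma std_seq_Not:
  assumes "d 1 = 1" "d' 1 = Suc (d 2)" "\<And>i. i \<ge> 2 \<Longrightarrow> d' i = d (Suc i)"
  shows "std_seq d' k = map Not (std_seq d (Suc k))"
  using assms
proof (induction d' k rule: std_seq.induct)
  case (3 d')
  then show ?case by (simp add: map_wpow numeral_2_eq_2)
next
  case (4 d' k)
  then show ?case by (simp add: map_wpow)
qed auto

text \<open>A continued fraction descent: \<open>phi\<close> lowers \<open>d 1\<close> to 1 (inner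
  induction), then the exchange of letters drops the first term and lowers the index (outer
  induction).\<close>

lemma rev_std_std_seq:
  assumes "\<forall>i\<ge>1. d i \<ge> 1"
  shows "rev_std (rev (std_seq d k))"
  using assms
proof (induction k arbitrary: d)
  case 0
  then show ?case by (simp add: rev_std_one)
next
  case (Suc k)
  have "rev_std (rev (std_seq d (Suc k)))" if "\<forall>i\<ge>1. d i \<ge> 1" "d 1 = Suc m" for m d
    using that
  proof (induction m arbitrary: d)
    case 0
    define d' where "d' = (\<lambda>i. if i = 1 then Suc (d 2) else d (Suc i))"
    have "rev_std (rev (std_seq d' k))"
      using 0 by (intro Suc.IH) (auto simp: d'_def)
    moreover have "std_seq d' k = map Not (std_seq d (Suc k))"
      using 0 by (intro std_seq_Not) (auto simp: d'_def)
    ultimately have "rev_std (map Not (map Not (rev (std_seq d (Suc k)))))"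
      by (metis rev_std.map_Not rev_map)
    then show ?case by (simp add: comp_def)
  next
    case (Suc m)
    define d' where "d' = d(1 := Suc m)"
    have "rev_std (rev (std_seq d' (Suc k)))"
      using Suc by (intro Suc.IH) (auto simp: d'_def)
    moreover have "rev (std_seq d (Suc k)) = phi (rev (std_seq d' (Suc k)))"
      using Suc by (intro std_seq_phi) (auto simp: d'_def)
    ultimately show ?case by (simp add: rev_std.phi)
  qed
  moreover obtain m where "d 1 = Suc m"
    using Suc.prems by (metis Suc_le_D One_nat_def order_refl)
  ultimately show ?case using Suc.prems by blast
qed

lemma standard_word_Not:
  assumes "standard_word u"
  shows "standard_word (map Not u)"
proof -
  obtain d k where d: "\<forall>i\<ge>1. d i \<ge> 1" and u: "u = std_seq d k"
    using assms by (auto simp: standard_word_def)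
  consider "d 1 = 1" "k = 0" | k' where "d 1 = 1" "k = Suc k'" | m where "d 1 = Suc (Suc m)"
    using d by (metis One_nat_def Suc_le_D order_refl not0_implies_Suc)
  then show ?thesis
  proof cases
    case 1
    then have "map Not u = std_seq d 1" using u by simp
    then show ?thesis using d unfolding standard_word_def by blast
  next
    case 2
    define d' where "d' = (\<lambda>i. if i = 1 then Suc (d 2) else d (Suc i))"
    have "std_seq d' k' = map Not u"
      unfolding u 2 using 2 by (intro std_seq_Not) (auto simp: d'_def)
    moreover have "\<forall>i\<ge>1. d' i \<ge> 1" using d by (auto simp: d'_def)
    ultimately show ?thesis by (metis standard_word_def)
  next
    case 3
    \<comment> \<open>The shift of \<open>std_seq_Not\<close> run backwards: the sequence 1,
      \<open>d 1 - 1\<close>, \<open>d 2\<close>, \<open>d 3\<close>, ... consists of positive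
      integers because \<open>d 1\<close> is at least 2.\<close>
    define d' where "d' = (\<lambda>i. if i = 1 then 1 else if i = 2 then d 1 - 1 else d (i - 1))"
    have "std_seq d k = map Not (std_seq d' (Suc k))"
      using 3 by (intro std_seq_Not) (auto simp: d'_def)
    then have "map Not u = std_seq d' (Suc k)"
      by (simp add: u comp_def)
    moreover have "\<forall>i\<ge>1. d' i \<ge> 1"
      using d 3 by (auto simp: d'_def)
    ultimately show ?thesis by (auto simp: standard_word_def)
  qed
qed

lemma standard_word_rev_phi:
  assumes "standard_word (rev w)"
  shows "standard_word (rev (phi w))"
proof -
  obtain d k where d: "\<forall>i\<ge>1. d i \<ge> 1" and w: "rev w = std_seq d k"
    using assms by (auto simp: standard_word_def)
  show ?thesis
  proof (cases k)
    case 0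
    \<comment> \<open>Here \<open>w\<close> is the letter 1, which \<open>std_seq_phi\<close> does
      not cover; the word 01 is $s_1$ for first exponent 2.\<close>
    then have "rev (phi w) = std_seq (\<lambda>_. 2) 2"
      using w by (simp add: numeral_2_eq_2)
    then show ?thesis unfolding standard_word_def
      by (intro exI[of _ "\<lambda>_. 2"] exI[of _ 2]) auto
  next
    case (Suc j)
    define d' where "d' = d(1 := Suc (d 1))"
    have "rev (std_seq d' k) = phi (rev (std_seq d k))"
      using d Suc by (intro std_seq_phi) (auto simp: d'_def)
    then have "rev (phi w) = std_seq d' k"
      by (metis w rev_rev_ident)
    moreover have "\<forall>i\<ge>1. d' i \<ge> 1" using d by (auto simp: d'_def)
    ultimately show ?thesis by (auto simp: standard_word_def)
  qed
qed

lemma standard_word_iff_rev_std: "standard_word u \<longleftrightarrow> rev_std (rev u)"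
proof
  assume "standard_word u"
  then show "rev_std (rev u)"
    by (auto simp: standard_word_def rev_std_std_seq)
next
  have "standard_word (rev w)" if "rev_std w" for w
    using that
  proof induction
    case zero
    have "rev [ltr0] = std_seq (\<lambda>_. 1) 1" by simp
    then show ?case unfolding standard_word_def by (intro exI[of _ "\<lambda>_. 1"] exI[of _ 1]) auto
  next
    case (map_Not w)
    then show ?case using standard_word_Not by (metis rev_map)
  qed (rule standard_word_rev_phi)
  then show "rev_std (rev u) \<Longrightarrow> standard_word u" by fastforce
qed


subsection \<open>Reversed standard words are solutions\<close>

text \<open>Blocks are nonempty, so a finite factor meets only finitely many of them; conversely a
  finite concatenation extends to an infinite one by padding with \<open>S5 a b\<close>.\<close>

lemma lang_iff_sublist:
  "u \<in> lang a b \<longleftrightarrow> (\<exists>fs. set fs \<subseteq> {S5 a b, S6 a b} \<and> sublist u (concat fs))"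
proof
  assume "u \<in> lang a b"
  then obtain f x i where f: "\<forall>n. f n \<in> {S5 a b, S6 a b}" and x: "inf_concat f x"
    and u: "u = map x [i..<i + length u]"
    by (auto simp: lang_def)
  have "length (concat (map f [0..<n])) \<ge> n" for n
  proof (induction n)
    case (Suc n)
    moreover have "length (f n) \<ge> 1" using f[rule_format, of n] by (auto simp: S5_def S6_def)
    ultimately show ?case by simp
  qed simp
  then obtain k where k: "length (concat (map f [0..<i + length u])) = i + length u + k"
    by (metis le_Suc_ex)
  have "concat (map f [0..<i + length u]) = map x [0..<i + length u + k]"
    using x k by (metis inf_concat_def)
  also have "[0..<i + length u + k] = [0..<i] @ [i..<i + length u] @ [i + length u..<i + length u + k]"
    by (simp add: upt_add_eq_append[of 0 "i + length u"] upt_add_eq_append[of 0 i])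
  finally have "concat (map f [0..<i + length u]) =
    map x [0..<i] @ u @ map x [i + length u..<i + length u + k]"
    using u by simp
  then show "\<exists>fs. set fs \<subseteq> {S5 a b, S6 a b} \<and> sublist u (concat fs)"
    using f by (intro exI[of _ "map f [0..<i + length u]"]) auto
next
  assume "\<exists>fs. set fs \<subseteq> {S5 a b, S6 a b} \<and> sublist u (concat fs)"
  then obtain fs ps ss where fs: "set fs \<subseteq> {S5 a b, S6 a b}" and u: "concat fs = ps @ u @ ss"
    by (auto simp: sublist_def)
  define f where "f n = (if n < length fs then fs ! n else S5 a b)" for n
  have f: "f n \<in> {S5 a b, S6 a b}" for n
    using fs nth_mem[of n fs] unfolding f_def by (metis insertI1 subsetD)
  define c where "c n = concat (map f [0..<n])" for n
  have len: "length (c n) \<ge> n" for n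
  proof (induction n)
    case (Suc n)
    moreover have "length (f n) \<ge> 1" using f[of n] by (auto simp: S5_def S6_def)
    ultimately show ?case by (simp add: c_def)
  qed simp
  have pre: "\<exists>t. c n = c m @ t" if "m \<le> n" for m n
    using that by (metis c_def concat_append map_append le_Suc_ex upt_add_eq_append zero_le)
  \<comment> \<open>The word \<open>c (Suc i)\<close> has more than \<open>i\<close> letters, and
    the \<open>c n\<close> are prefixes of one another.\<close>
  define x where "x i = c (Suc i) ! i" for i
  have x: "map x [0..<length (c n)] = c n" for n
  proof (rule nth_equalityI)
    fix i assume "i < length (map x [0..<length (c n)])"
    then have i: "i < length (c n)" by simp
    have "i < length (c (Suc i))" using len[of "Suc i"] by simp
    then have "c (Suc i) ! i = c n ! i"
      using pre[of n "Suc i"] pre[of "Suc i" n] i by (metis nle_le nth_append)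
    then show "map x [0..<length (c n)] ! i = c n ! i" using i by (simp add: x_def)
  qed simp
  have "map f [0..<length fs] = fs"
    by (rule nth_equalityI) (auto simp: f_def)
  then have "c (length fs) = ps @ u @ ss" using u by (simp add: c_def)
  then have "ps @ u @ ss = map x [0..<length ps + length u + length ss]"
    using x[of "length fs"] by (simp add: add.assoc)
  then have "u = take (length u) (drop (length ps) (map x [0..<length ps + length u + length ss]))"
    by (metis append_eq_conv_conj)
  also have "\<dots> = map x [length ps..<length ps + length u]"
    by (simp add: drop_map take_map take_upt)
  finally have "u = map x [length ps..<length ps + length u]" .
  moreover have "inf_concat f x"
    using x by (simp add: inf_concat_def c_def)
  ultimately show "u \<in> lang a b"
    using f unfolding lang_def by blast
qed

section \<open>Factorizations whose squares multiply to a square\<close>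

text \<open>The factorization condition of \<open>solution_with\<close>, split off from membership
  in \<open>lang\<close> because the two are transported by different arguments.\<close>

definition rootable :: "nat \<Rightarrow> nat \<Rightarrow> word \<Rightarrow> bool" where
  "rootable a b w \<longleftrightarrow>
     (\<exists>Xs. set Xs \<subseteq> S_words a b \<and> concat Xs = w \<and> concat (map (\<lambda>X. X @ X) Xs) = w @ w)"

lemma rootableI:
  "set Xs \<subseteq> S_words a b \<Longrightarrow> concat Xs = w \<Longrightarrow> concat (map (\<lambda>X. X @ X) Xs) = w @ w \<Longrightarrow>
   rootable a b w"
  by (auto simp: rootable_def)

lemma rootable_S_words: "w \<in> S_words a b \<Longrightarrow> rootable a b w"
  by (intro rootableI[of "[w]"]) auto

lemma solution_with_iff:
  "solution_with a b v \<longleftrightarrow> v \<noteq> [] \<and> v @ v \<in> lang a b \<and> rootable a b v"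
proof -
  have "rootable a b v \<longleftrightarrow> (\<exists>Xs. set Xs \<subseteq> S_words a b \<and> v = concat Xs \<and>
      concat (map (\<lambda>X. X @ X) Xs) = concat Xs @ concat Xs)" (is "_ \<longleftrightarrow> ?R")
    by (auto simp: rootable_def)
  moreover have "\<exists>Xs. set Xs \<subseteq> S_words a b \<and> v @ v = concat (map (\<lambda>X. X @ X) Xs)" if ?R
    using that by auto
  ultimately show ?thesis
    unfolding solution_with_def square_products_def by blast
qed

text \<open>Refinement: each factor is replaced by its own factorization, whose squares multiply to
  the square of that factor. Hence rootable words may serve as factors in place of the S_i.\<close>

lemma rootable_concat:
  assumes "\<And>X. X \<in> set Xs \<Longrightarrow> rootable a b X"
  obtains Ys where "set Ys \<subseteq> S_words a b" "concat Ys = concat Xs"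
    "concat (map (\<lambda>X. X @ X) Ys) = concat (map (\<lambda>X. X @ X) Xs)"
  using assms
proof (induction Xs arbitrary: thesis)
  case Nil
  then show ?case by (metis concat.simps(1) empty_set empty_subsetI list.simps(8))
next
  case (Cons X Xs)
  obtain Ys where Ys: "set Ys \<subseteq> S_words a b" "concat Ys = concat Xs"
    "concat (map (\<lambda>X. X @ X) Ys) = concat (map (\<lambda>X. X @ X) Xs)"
    using Cons.IH Cons.prems(2) by (metis list.set_intros(2))
  obtain Zs where "set Zs \<subseteq> S_words a b" "concat Zs = X" "concat (map (\<lambda>X. X @ X) Zs) = X @ X"
    using Cons.prems(2)[of X] by (auto simp: rootable_def)
  then show ?case using Ys by (intro Cons.prems(1)[of "Zs @ Ys"]) auto
qed

lemma rootable_concatI: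
  assumes "\<And>X. X \<in> set Xs \<Longrightarrow> rootable a b X"
    and "concat Xs = w" "concat (map (\<lambda>X. X @ X) Xs) = w @ w"
  shows "rootable a b w"
proof -
  obtain Ys where "set Ys \<subseteq> S_words a b" "concat Ys = concat Xs"
    "concat (map (\<lambda>X. X @ X) Ys) = concat (map (\<lambda>X. X @ X) Xs)"
    using rootable_concat[OF assms(1)] by blast
  then show ?thesis using assms(2,3) by (intro rootableI[of Ys]) simp_all
qed

lemma rootable_morphism:
  assumes "rootable a b w"
    and "\<And>X. X \<in> S_words a b \<Longrightarrow> rootable a' b' (f X)"
    and f: "f [] = []" "\<And>u v. f (u @ v) = f u @ f v"
  shows "rootable a' b' (f w)"
proof -
  obtain Xs where Xs: "set Xs \<subseteq> S_words a b" "concat Xs = w" "concat (map (\<lambda>X. X @ X) Xs) = w @ w"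
    using assms(1) by (auto simp: rootable_def)
  have f_concat: "f (concat Ys) = concat (map f Ys)" for Ys
    by (induction Ys) (auto simp: f)
  show ?thesis
  proof (rule rootable_concatI)
    show "concat (map f Xs) = f w" using f_concat[of Xs] Xs(2) by simp
    have "f (concat (map (\<lambda>X. X @ X) Xs)) = f w @ f w" using Xs(3) f by simp
    then show "concat (map (\<lambda>X. X @ X) (map f Xs)) = f w @ f w"
      by (simp add: f_concat comp_def f)
  qed (use Xs assms(2) in auto)
qed

section \<open>Closure of solutions under the substitution and the exchange\<close>

lemma solution_with_phi:
  assumes "a \<ge> 1" "solution_with a b v"
  shows "solution_with (Suc a) b (phi v)"
proof -
  obtain a' where a: "a = Suc a'" using assms(1) by (metis Suc_le_D One_nat_def)
  have S: "phi S1 = S1" "phi (S2 a) = S2 (Suc a)" "phi (S3 a) = S3 (Suc a)" "phi (S4 a) = S4 (Suc a)"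
    "phi (S5 a b) = S5 (Suc a) b" "phi (S6 a b) = S6 (Suc a) b"
    by (simp_all add: a S1_def S2_def S3_def S4_def S5_def S6_def phi_wpow)
  have v: "v \<noteq> []" "v @ v \<in> lang a b" "rootable a b v"
    using assms by (auto simp: solution_with_iff)
  have "rootable (Suc a) b (phi v)"
    using v(3) by (rule rootable_morphism) (auto simp: S_words_def S intro!: rootable_S_words)
  moreover have "phi v \<noteq> []" using v(1) by (cases v) auto
  moreover have "phi v @ phi v \<in> lang (Suc a) b"
  proof -
    obtain fs ps ss where fs: "set fs \<subseteq> {S5 a b, S6 a b}" "concat fs = ps @ (v @ v) @ ss"
      using v(2) by (auto simp: lang_iff_sublist sublist_def)
    have "concat (map phi fs) = phi (concat fs)"
      by (induction fs) auto
    also have "\<dots> = phi ps @ (phi v @ phi v) @ phi ss" using fs by simp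
    finally show ?thesis using fs(1) S unfolding lang_iff_sublist sublist_def
      by (intro exI[of _ "map phi fs"]) auto
  qed
  ultimately show ?thesis by (simp add: solution_with_iff)
qed

lemma S_one:
  "S2 (Suc 0) = [ltr0, ltr1]" "S3 (Suc 0) = ltr0 # [ltr1, ltr0]" "S4 (Suc 0) = [ltr1, ltr0]"
  "S5 (Suc 0) b = [ltr1, ltr0] @ ltr0 # wpow [ltr1, ltr0] b"
  "S6 (Suc 0) b = [ltr1, ltr0] @ ltr0 # wpow [ltr1, ltr0] (Suc b)"
  by (simp_all add: S2_def S3_def S4_def S5_def S6_def)

lemma zero_one_wpow: "wpow [ltr0, ltr1] m @ ltr0 # u = ltr0 # wpow [ltr1, ltr0] m @ u"
  by (induction m arbitrary: u) auto

lemma concat_map_dup_replicate: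
  "concat (map (\<lambda>X. X @ X) (replicate m u)) = wpow u (2 * m)"
  by (induction m) auto

text \<open>The factorizations are (01)^m 0 (10)^m and (01)^m 010 (10)^m. Squaring the factors
  doubles both outer exponents, and (01)^n 0 = 0 (10)^n turns the result into two equal
  halves.\<close>

lemma rootable_zero_wpow: "rootable (Suc 0) b (ltr0 # wpow [ltr1, ltr0] c)"
proof -
  let ?Xs = "\<lambda>m X. replicate m (S2 (Suc 0)) @ [X] @ replicate m (S4 (Suc 0))"
  have set: "set (?Xs m X) \<subseteq> S_words (Suc 0) b" if "X \<in> {S1, S3 (Suc 0)}" for m X
    using that by (auto simp: S_words_def)
  have comm: "wpow [ltr1, ltr0] m @ ltr1 # ltr0 # u = ltr1 # ltr0 # wpow [ltr1, ltr0] m @ u" for m u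
    using wpow_commute_append[of "[ltr1, ltr0]" m u] by simp
  consider m where "c = 2 * m" | m where "c = Suc (2 * m)" by (metis oddE evenE Suc_eq_plus1)
  then show ?thesis
  proof cases
    case 1
    show ?thesis
    proof (rule rootableI[OF set])
      show "concat (?Xs m S1) = ltr0 # wpow [ltr1, ltr0] c"
        by (simp add: 1 S_one S1_def zero_one_wpow mult_2 wpow_add flip: wpow_def)
      show "concat (map (\<lambda>X. X @ X) (?Xs m S1)) =
        (ltr0 # wpow [ltr1, ltr0] c) @ ltr0 # wpow [ltr1, ltr0] c"
        unfolding map_append concat_append concat_map_dup_replicate
        by (simp add: 1 S_one S1_def zero_one_wpow)
    qed simp
  next
    case 2
    show ?thesis
    proof (rule rootableI[OF set])
      show "concat (?Xs m (S3 (Suc 0))) = ltr0 # wpow [ltr1, ltr0] c"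
        by (simp add: 2 S_one zero_one_wpow mult_2 wpow_add comm flip: wpow_def)
      show "concat (map (\<lambda>X. X @ X) (?Xs m (S3 (Suc 0)))) =
        (ltr0 # wpow [ltr1, ltr0] c) @ ltr0 # wpow [ltr1, ltr0] c"
        unfolding map_append concat_append concat_map_dup_replicate
        by (simp add: 2 S_one zero_one_wpow comm)
    qed simp
  qed
qed

text \<open>
  With \<open>A = 10\<close> and \<open>B = 0A\<^sup>b\<close>, the factorizations are \<open>01 B (AB)\<^sup>k A C\<^sup>k\<close> for \<open>n = 2k\<close> and
  \<open>01 B (AB)\<^sup>k AC C\<^sup>k\<close> for \<open>n = 2k + 1\<close>. The words \<open>C A C\<^sup>n\<close> are the images of
  \<open>S5\<close> and \<open>S6\<close> under the substitution of \<open>solution_with_phi_Not\<close>.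
\<close>

lemma rootable_long:
  fixes b n :: nat
  defines "C \<equiv> ltr0 # wpow [ltr1, ltr0] (Suc b)"
  shows "rootable (Suc 0) b (C @ [ltr1, ltr0] @ wpow C n)"
proof -
  define A B where "A = [ltr1, ltr0]" and "B = ltr0 # wpow A b"
  let ?Xs = "\<lambda>k X. S2 (Suc 0) # B # replicate k (S5 (Suc 0) b) @ X # replicate k C"
  have S: "S4 (Suc 0) = A" "S5 (Suc 0) b = A @ B" "S6 (Suc 0) b = A @ C"
    by (simp_all add: S_one A_def B_def C_def)
  have S2B: "S2 (Suc 0) @ B @ u = C @ u" for u
    by (simp add: S_one A_def B_def C_def)
  have BA: "B @ A @ u = C @ u" for u
    using wpow_commute_append[of A b u] by (simp add: A_def B_def C_def)
  have S2C: "S2 (Suc 0) @ C @ u = C @ A @ u" for u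
    by (metis BA S2B)
  have shift: "wpow (A @ B) k @ A @ u = A @ wpow C k @ u" for k u
    using wpow_shift[of A B k] BA[of "[]"] by (metis append_assoc append_Nil2)
  \<comment> \<open>\<open>B\<close> and \<open>C\<close> need not be among the S_i;
    \<open>rootable_zero_wpow\<close> supplies their factorizations.\<close>
  have set: "rootable (Suc 0) b Y" if "Y \<in> set (?Xs k X)" "X \<in> S_words (Suc 0) b" for k X Y
  proof -
    have "Y \<in> S_words (Suc 0) b \<or> Y = B \<or> Y = C"
      using that by (auto simp: S_words_def)
    then show ?thesis
      using rootable_zero_wpow[of b b] rootable_zero_wpow[of b "Suc b"] rootable_S_words
      unfolding B_def C_def A_def by blast
  qed
  \<comment> \<open>The identities 01 B = B A = C, 01 C = C A and (AB)^k A = A C^k bring both sides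
    to the same word over \<open>A\<close> and \<open>C\<close>.\<close>
  note norm = S S2B BA S2C shift wpow_commute_append wpow_commute
  consider k where "n = 2 * k" | k where "n = Suc (2 * k)" by (metis oddE evenE Suc_eq_plus1)
  then show ?thesis
  proof cases
    case 1
    show ?thesis unfolding A_def[symmetric]
    proof (rule rootable_concatI[OF set])
      show "concat (?Xs k (S4 (Suc 0))) = C @ A @ wpow C n"
        by (simp add: 1 norm mult_2 wpow_add flip: wpow_def)
      show "concat (map (\<lambda>X. X @ X) (?Xs k (S4 (Suc 0)))) = (C @ A @ wpow C n) @ C @ A @ wpow C n"
        unfolding map_append concat_append list.map concat.simps concat_map_dup_replicate
        by (simp add: 1 norm)
    qed (auto simp: S_words_def)
  next
    case 2
    show ?thesis unfolding A_def[symmetric]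
    proof (rule rootable_concatI[OF set])
      show "concat (?Xs k (S6 (Suc 0) b)) = C @ A @ wpow C n"
        by (simp add: 2 norm mult_2 wpow_add flip: wpow_def)
      show "concat (map (\<lambda>X. X @ X) (?Xs k (S6 (Suc 0) b))) = (C @ A @ wpow C n) @ C @ A @ wpow C n"
        unfolding map_append concat_append list.map concat.simps concat_map_dup_replicate
        by (simp add: 2 norm)
    qed (auto simp: S_words_def)
  qed
qed

text \<open>The composite \<open>f\<close> sends 0 to 10 and 1 to 0. It maps S_1, S_2, S_3 to S_4,
  S_5, S_6 of parameters (1, a - 1); the images of S_4, S_5, S_6 are covered by
  \<open>rootable_zero_wpow\<close> and \<open>rootable_long\<close>.\<close>

lemma solution_with_phi_Not:
  assumes "a \<ge> 1" "solution_with a b (map Not v)"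
  shows "solution_with 1 (a - 1) (phi v)"
proof -
  define f where "f w = phi (map Not w)" for w
  define A C where "A = [ltr1, ltr0]" and "C = ltr0 # wpow A a"
  obtain c where a: "a = Suc c" using assms(1) by (metis Suc_le_D One_nat_def)
  have f: "f [] = []" "f (u @ w) = f u @ f w" for u w by (simp_all add: f_def)
  have S: "f S1 = S4 (Suc 0)" "f (S2 a) = S5 (Suc 0) c" "f (S3 a) = S6 (Suc 0) c" "f (S4 a) = C"
    by (simp_all add: a f_def S1_def S2_def S3_def S4_def S_one phi_wpow map_wpow C_def A_def)
  have f_long: "f ([ltr1] @ wpow [ltr0] (a + 1) @ wpow ([ltr1] @ wpow [ltr0] a) n) = C @ A @ wpow C n" for n
    using wpow_commute_append[of A a "wpow C n"]
    by (simp add: f_def phi_wpow map_wpow C_def A_def)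
  have v: "map Not v \<noteq> []" "map Not v @ map Not v \<in> lang a b" "rootable a b (map Not v)"
    using assms by (auto simp: solution_with_iff)
  have "rootable (Suc 0) c (C @ A @ wpow C n)" for n
    using rootable_long[of c n] by (simp add: C_def A_def a)
  then have "rootable (Suc 0) c (f (S5 a b))" "rootable (Suc 0) c (f (S6 a b))"
    by (simp_all only: S5_def S6_def f_long)
  moreover have "rootable (Suc 0) c (f (S4 a))"
    using rootable_zero_wpow by (simp add: S C_def A_def)
  moreover have "rootable (Suc 0) c (f S1)" "rootable (Suc 0) c (f (S2 a))"
    "rootable (Suc 0) c (f (S3 a))"
    by (simp_all add: S S_words_def rootable_S_words)
  ultimately have "\<forall>X\<in>S_words a b. rootable (Suc 0) c (f X)"
    by (simp add: S_words_def)
  then have "rootable (Suc 0) c (f (map Not v))"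
    using rootable_morphism[where f = f, OF v(3) _ f] by blast
  moreover have "f (map Not v) \<noteq> []" using v(1) by (cases v) (auto simp: f_def)
  moreover have "f (map Not v) @ f (map Not v) \<in> lang (Suc 0) c"
  proof -
    let ?S = "{S5 (Suc 0) c, S6 (Suc 0) c}"
    obtain fs ps ss where fs: "set fs \<subseteq> {S5 a b, S6 a b}"
      and eq: "concat fs = ps @ (map Not v @ map Not v) @ ss"
      using v(2) by (auto simp: lang_iff_sublist sublist_def)
    \<comment> \<open>The images of S_5 and S_6 become concatenations of the new S_5 and S_6 only
      after conjugation by \<open>A\<close>: A C A C^n = S_6 (S_5)^n A.\<close>
    have "\<exists>gs. set gs \<subseteq> ?S \<and> A @ C @ A @ wpow C n = concat gs @ A" for n
    proof -
      have "C = (ltr0 # wpow A c) @ A" "S5 (Suc 0) c = A @ (ltr0 # wpow A c)" "S6 (Suc 0) c = A @ C"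
        using wpow_commute[of A c] by (simp_all add: S_one A_def C_def a)
      then have "A @ C @ A @ wpow C n = concat (S6 (Suc 0) c # replicate n (S5 (Suc 0) c)) @ A"
        using wpow_shift[of A "ltr0 # wpow A c" n] by (simp flip: wpow_def)
      then show ?thesis by (intro exI[of _ "S6 (Suc 0) c # replicate n (S5 (Suc 0) c)"]) auto
    qed
    then have "\<exists>gs. set gs \<subseteq> ?S \<and> A @ f (S5 a b) = concat gs @ A"
      "\<exists>gs. set gs \<subseteq> ?S \<and> A @ f (S6 a b) = concat gs @ A"
      by (simp_all only: S5_def[of a] S6_def[of a] f_long)
    then have step: "\<exists>gs. set gs \<subseteq> ?S \<and> A @ f X = concat gs @ A" if "X \<in> {S5 a b, S6 a b}" for X
      using that by blast
    have "\<exists>gs. set gs \<subseteq> ?S \<and> A @ f (concat fs) = concat gs @ A"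
      using fs
    proof (induction fs)
      case Nil
      then show ?case by (intro exI[of _ "[]"]) (simp add: f)
    next
      case (Cons X fs)
      then obtain gs gs' where gs: "set gs \<subseteq> ?S" "A @ f X = concat gs @ A"
        and gs': "set gs' \<subseteq> ?S" "A @ f (concat fs) = concat gs' @ A"
        using step[of X] by (metis insert_subset list.simps(15))
      have "A @ f (concat (X # fs)) = (A @ f X) @ f (concat fs)" by (simp add: f)
      also have "\<dots> = concat gs @ A @ f (concat fs)" unfolding gs(2) by simp
      also have "\<dots> = concat (gs @ gs') @ A" unfolding gs'(2) by simp
      finally show ?case using gs(1) gs'(1) by (intro exI[of _ "gs @ gs'"]) simp
    qed
    then obtain gs where gs: "set gs \<subseteq> ?S" "A @ f (concat fs) = concat gs @ A" by blast
    \<comment> \<open>The \<open>A\<close> left over at the end is completed to a whole block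
      \<open>S5\<close>.\<close>
    have "S5 (Suc 0) c = A @ ltr0 # wpow A c" by (simp add: S_one A_def)
    then have "concat (gs @ [S5 (Suc 0) c]) = (concat gs @ A) @ ltr0 # wpow A c" by simp
    also have "\<dots> = (A @ f ps) @ (f (map Not v) @ f (map Not v)) @ f ss @ ltr0 # wpow A c"
      unfolding gs(2)[symmetric] eq by (simp add: f)
    finally have "concat (gs @ [S5 (Suc 0) c]) =
      (A @ f ps) @ (f (map Not v) @ f (map Not v)) @ f ss @ ltr0 # wpow A c" .
    then have "sublist (f (map Not v) @ f (map Not v)) (concat (gs @ [S5 (Suc 0) c]))"
      unfolding sublist_def by blast
    then show ?thesis using gs(1) unfolding lang_iff_sublist
      by (intro exI[of _ "gs @ [S5 (Suc 0) c]"]) simp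
  qed
  ultimately have "solution_with (Suc 0) c (f (map Not v))" by (simp add: solution_with_iff)
  then show ?thesis by (simp add: a f_def comp_def)
qed

lemma solution_Not: "solution v \<Longrightarrow> solution (map Not v)"
  by (auto simp: solution_def comp_def)

lemma solution_phi:
  assumes "solution v"
  shows "solution (phi v)"
proof -
  obtain a b where "a \<ge> 1" "solution_with a b v \<or> solution_with a b (map Not v)"
    using assms by (auto simp: solution_def)
  then have "solution_with (Suc a) b (phi v) \<or> solution_with 1 (a - 1) (phi v)"
    using solution_with_phi solution_with_phi_Not by blast
  moreover have "Suc a \<ge> 1" "(1::nat) \<ge> 1" by simp_all
  ultimately show ?thesis unfolding solution_def by blast
qed

lemma solution_zero: "solution [ltr0]"
proof -
  have "concat [S5 1 0] = [ltr1] @ ([ltr0] @ [ltr0]) @ []" by (simp add: S5_def)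
  then have "sublist ([ltr0] @ [ltr0]) (concat [S5 1 0])" unfolding sublist_def by blast
  then have "[ltr0] @ [ltr0] \<in> lang 1 0"
    unfolding lang_iff_sublist by (intro exI[of _ "[S5 1 0]"]) simp
  moreover have "rootable 1 0 [ltr0]"
    by (intro rootable_S_words) (simp add: S_words_def S1_def)
  ultimately have "solution_with 1 0 [ltr0]" by (simp add: solution_with_iff)
  then show ?thesis unfolding solution_def by blast
qed

lemma solution_if_rev_std: "rev_std v \<Longrightarrow> solution v"
  by (induction rule: rev_std.induct) (auto intro: solution_zero solution_Not solution_phi)

text \<open>With N the length and p the number of 1s, the exchange replaces p by N - p and
  \<open>phi\<close> replaces N by N + p.\<close>

lemma gcd_if_rev_std: "rev_std v \<Longrightarrow> gcd (length v) (count_list v ltr1) = 1"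
proof (induction rule: rev_std.induct)
  case (map_Not w)
  then show ?case
    using gcd_diff2_nat[OF count_list_le_length[of w ltr1]]
    by (simp add: count_list_map_Not gcd.commute)
next
  case (phi w)
  then show ?case by simp
qed simp


subsection \<open>Solutions are balanced\<close>

text \<open>A path rising by \<open>N - p\<close> at each 1 and falling by \<open>p\<close> at each
  0. \<open>N\<close> and \<open>p\<close> are parameters so that factors of a word can be measured
  with the slope of the whole word.\<close>

definition height :: "int \<Rightarrow> int \<Rightarrow> word \<Rightarrow> int" where
  "height N p w = N * int (count_list w ltr1) - p * int (length w)"

lemma height_simps [simp]:
  "height N p [] = 0"
  "height N p (c # w) = (if c then N - p else - p) + height N p w"
  "height N p (u @ v) = height N p u + height N p v"
  "height N p (replicate n ltr0) = - int n * p"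
  by (auto simp: height_def algebra_simps)

lemma height_wpow [simp]: "height N p (wpow u n) = int n * height N p u"
  by (induction n) (auto simp: algebra_simps)

lemma prefix_concat_cases:
  assumes "prefix w (concat Xs)" "Xs \<noteq> []"
  obtains Ps y z Qs where "Xs = Ps @ (y @ z) # Qs" "w = concat Ps @ y"
  using assms
proof (induction Xs arbitrary: w thesis)
  case (Cons X Xs)
  consider "prefix w X" | w' where "w = X @ w'" "prefix w' (concat Xs)"
    using Cons.prems(2) by (auto simp: prefix_append)
  then show ?case
  proof cases
    case 1
    then obtain z where "X = w @ z" by (auto simp: prefix_def)
    then show ?thesis using Cons.prems(1)[of "[]" w z Xs] by simp
  next
    case 2
    show ?thesis
    proof (cases "Xs = []")
      case True
      then show ?thesis using 2 Cons.prems(1)[of "[]" X "[]" "[]"] by simp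
    next
      case False
      obtain Ps y z Qs where "Xs = Ps @ (y @ z) # Qs" "w' = concat Ps @ y"
        using Cons.IH[OF _ 2(2) False] by blast
      then show ?thesis using 2 Cons.prems(1)[of "X # Ps" y z Qs] by simp
    qed
  qed
qed simp

text \<open>
  Let the maximum of \<open>h\<close> over the prefixes of \<open>v @ v\<close> be attained at \<open>P @ y\<close>, where \<open>v\<close> factors as
  \<open>P\<close>, then \<open>X = y @ z\<close>, and a rest. The two copies of \<open>X\<close> in \<open>v @ v\<close> start at the heights
  \<open>2 * h P\<close> and \<open>2 * h P + h X\<close>, so maximality gives \<open>h P \<le> 0\<close> and \<open>h P + h X \<le> 0\<close>.
  Hence the maximum is at most both \<open>h y\<close> and \<open>- h z\<close>.
\<close>

lemma height_bounded_if_squares: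
  fixes h :: "word \<Rightarrow> int"
  assumes sq: "concat (map (\<lambda>X. X @ X) Xs) = v @ v" and v: "concat Xs = v"
    and h: "h [] = 0" "\<And>u w. h (u @ w) = h u + h w" "h v = 0"
    and c: "0 \<le> c" "\<And>X y z. X \<in> set Xs \<Longrightarrow> X = y @ z \<Longrightarrow> h y \<le> c \<or> - h z \<le> c"
    and w: "prefix w v"
  shows "h w \<le> c"
proof (cases "Xs = []")
  case False
  define M where "M = Max (h ` set (prefixes v))"
  have le_M: "h u \<le> M" if "prefix u v" for u
    unfolding M_def using that by (intro Max_ge) auto
  have "M \<in> h ` set (prefixes v)"
    unfolding M_def by (intro Max_in) auto
  then obtain u where u: "prefix u v" "h u = M" by auto
  have le_M2: "h u \<le> M" if "prefix u (v @ v)" for u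
    using that le_M h by (auto simp: prefix_append)
  obtain Ps y z Qs where Xs: "Xs = Ps @ (y @ z) # Qs" and uy: "u = concat Ps @ y"
    using prefix_concat_cases[of u Xs] u(1) False unfolding v by blast
  define P2 where "P2 = concat (map (\<lambda>X. X @ X) Ps)"
  have hP2: "h P2 = 2 * h (concat Ps)"
    unfolding P2_def by (induction Ps) (auto simp: h)
  have "prefix (P2 @ y) (v @ v)" "prefix (P2 @ y @ z @ y) (v @ v)"
    unfolding sq[symmetric] by (simp_all add: Xs P2_def)
  then have "h (P2 @ y) \<le> h u" "h (P2 @ y @ z @ y) \<le> h u"
    using le_M2 u by auto
  then have "h (concat Ps) \<le> 0" "h (concat Ps) + h y + h z \<le> 0"
    by (simp_all add: uy h hP2)
  moreover have "h y \<le> c \<or> - h z \<le> c" using c(2)[of "y @ z" y z] Xs by simp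
  ultimately have "h u \<le> c" unfolding uy h by linarith
  then show ?thesis using le_M[OF w] u(2) by linarith
qed (use c w v h(1) in simp)

section \<open>Heights inside the words S_1, ..., S_6\<close>

text \<open>The hypothesis of \<open>height_bounded_if_squares\<close> on a factor, for the height
  with bound \<open>N - p\<close> and for its negative with bound \<open>p\<close>.\<close>

definition tame :: "int \<Rightarrow> int \<Rightarrow> word \<Rightarrow> bool" where
  "tame N p X \<longleftrightarrow> (\<forall>y z. X = y @ z \<longrightarrow>
     (height N p y \<le> N - p \<or> - height N p z \<le> N - p) \<and> (- p \<le> height N p y \<or> - p \<le> - height N p z))"

lemma replicate_eq_append:
  assumes "replicate n c = y @ z"
  obtains i where "i \<le> n" "y = replicate i c" "z = replicate (n - i) c"
proof
  show n: "length y \<le> n" using arg_cong[OF assms, of length] by simp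
  have "y = take (length y) (replicate n c)" "z = drop (length y) (replicate n c)"
    using assms by simp_all
  then show "y = replicate (length y) c" "z = replicate (n - length y) c"
    using n by (simp_all add: min_absorb1)
qed

lemma one_zeros_eq_append:
  assumes "ltr1 # replicate n ltr0 = y @ z" "y \<noteq> []"
  obtains i where "i \<le> n" "y = ltr1 # replicate i ltr0" "z = replicate (n - i) ltr0"
proof -
  from assms obtain y' where "y = ltr1 # y'" "replicate n ltr0 = y' @ z"
    by (auto simp: Cons_eq_append_conv)
  moreover from this(2) obtain i where "i \<le> n" "y' = replicate i ltr0" "z = replicate (n - i) ltr0"
    by (rule replicate_eq_append)
  ultimately show thesis using that[of i] by simp
qed

lemma wpow_eq_append:
  assumes "wpow u n = y @ z" "z \<noteq> []"
  obtains j k y' z' where "y = wpow u j @ y'" "z = z' @ wpow u k" "u = y' @ z'"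
  using assms
proof (induction n arbitrary: y thesis)
  case (Suc n)
  have "u @ wpow u n = y @ z" using Suc.prems by simp
  then consider y' where "y = u @ y'" "wpow u n = y' @ z" | z' where "u = y @ z'" "z = z' @ wpow u n"
    unfolding append_eq_append_conv2[of u] by blast
  then show ?case
  proof cases
    case 1
    then obtain j k y1 z1 where "y' = wpow u j @ y1" "z = z1 @ wpow u k" "u = y1 @ z1"
      using Suc.IH[OF _ 1(2) Suc.prems(3)] by blast
    then show ?thesis using 1 Suc.prems(1)[of "Suc j" y1 z1 k] by simp
  next
    case 2
    then show ?thesis using Suc.prems(1)[of 0 y z' n] by simp
  qed
qed simp

text \<open>The peak \<open>N - p\<close> comes right after the 1. Past it only zeros remain, so the
  height measured back from the end is nonnegative.\<close>

lemma tame_one_zeros: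
  assumes "0 \<le> p" "p \<le> N"
  shows "tame N p (ltr1 # replicate n ltr0)"
  unfolding tame_def
proof (intro allI impI)
  fix y z assume eq: "ltr1 # replicate n ltr0 = y @ z"
  show "(height N p y \<le> N - p \<or> - height N p z \<le> N - p) \<and>
    (- p \<le> height N p y \<or> - p \<le> - height N p z)"
  proof (cases "y = []")
    case False
    then obtain i where i: "y = ltr1 # replicate i ltr0" "z = replicate (n - i) ltr0"
      using one_zeros_eq_append[OF eq False] by blast
    have "0 \<le> int i * p" "height N p z \<le> 0"
      using assms by (simp_all add: i del: of_nat_diff)
    moreover have "height N p y = N - p - int i * p" by (simp add: i)
    ultimately show ?thesis using assms by linarith
  qed (use assms in auto)
qed

lemma tame_zero_one_zeros:
  assumes "0 \<le> p" "p \<le> N"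
  shows "tame N p (ltr0 # ltr1 # replicate n ltr0)"
  unfolding tame_def
proof (intro allI impI)
  fix y z assume eq: "ltr0 # ltr1 # replicate n ltr0 = y @ z"
  then consider "y = []" | "y = [ltr0]" | y' where "y = ltr0 # y'" "y' \<noteq> []" "ltr1 # replicate n ltr0 = y' @ z"
    by (auto simp: Cons_eq_append_conv)
  then show "(height N p y \<le> N - p \<or> - height N p z \<le> N - p) \<and>
    (- p \<le> height N p y \<or> - p \<le> - height N p z)"
  proof cases
    case 3
    then obtain i where i: "y' = ltr1 # replicate i ltr0" "z = replicate (n - i) ltr0"
      using one_zeros_eq_append[OF 3(3,2)] by blast
    have "0 \<le> int i * p" "height N p z \<le> 0"
      using assms by (simp_all add: i del: of_nat_diff)
    moreover have "height N p y = N - 2 * p - int i * p" by (simp add: 3(1) i)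
    ultimately show ?thesis using assms by linarith
  qed (use assms in auto)
qed

text \<open>Each copy of 10^a changes the height by \<open>\<delta>\<close>. If the drift is upward,
  the lower bound holds measured from the start, and the upper bound, for cuts among the copies,
  measured back from the end. If it is downward, the upper bound holds from the start and the lower
  bound from the end.\<close>

lemma tame_long:
  assumes p: "0 \<le> p" "p \<le> N"
  shows "tame N p ((ltr1 # replicate (Suc a) ltr0) @ wpow (ltr1 # replicate a ltr0) n)"
  unfolding tame_def
proof (intro allI impI)
  let ?W = "ltr1 # replicate a ltr0" and ?V = "ltr1 # replicate (Suc a) ltr0"
  let ?goal = "\<lambda>y z. (height N p y \<le> N - p \<or> - height N p z \<le> N - p) \<and>
    (- p \<le> height N p y \<or> - p \<le> - height N p z)"
  fix y z assume eq: "?V @ wpow ?W n = y @ z"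
  define \<delta> where "\<delta> = N - p - int a * p"
  have hW: "height N p ?W = \<delta>" and hV: "height N p ?V = \<delta> - p"
    by (simp_all add: \<delta>_def algebra_simps)
  have "?goal y z" if ne: "y \<noteq> []" "z \<noteq> []"
    using eq unfolding append_eq_append_conv2[of ?V]
  proof (elim exE disjE conjE)
    fix us assume us: "?V = y @ us" "us @ wpow ?W n = z"
    obtain i where i: "i \<le> Suc a" "y = ltr1 # replicate i ltr0" "us = replicate (Suc a - i) ltr0"
      by (rule one_zeros_eq_append[OF us(1) ne(1)])
    have ip: "0 \<le> int i * p" "0 \<le> int (Suc a - i) * p"
      using p(1) by (simp_all del: of_nat_diff)
    have "int (Suc a - i) * p = p + int a * p - int i * p"
      using i(1) by (simp add: algebra_simps)
    note ip = ip this
    have hy: "height N p y = N - p - int i * p" using i by simp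
    have hz: "- height N p z = int (Suc a - i) * p - int n * \<delta>"
      unfolding us(2)[symmetric] i(3) height_simps(3,4) height_wpow hW by simp
    show ?thesis
    proof (cases "\<delta> \<ge> 0")
      case True
      then show ?thesis using hy ip by (simp add: \<delta>_def)
    next
      case False
      then have "int n * \<delta> \<le> 0" by (simp add: mult_le_0_iff)
      then show ?thesis using hy hz ip p by simp
    qed
  next
    fix us assume us: "?V @ us = y" "wpow ?W n = us @ z"
    obtain j k y' z' where jk: "us = wpow ?W j @ y'" "z = z' @ wpow ?W k" "?W = y' @ z'"
      by (rule wpow_eq_append[OF us(2) ne(2)])
    have hy: "height N p y = \<delta> - p + int j * \<delta> + height N p y'"
      unfolding us(1)[symmetric] jk(1) height_simps(3) height_wpow hV hW by simp
    have hz: "- height N p z = - height N p z' - int k * \<delta>"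
      unfolding jk(2) height_simps(3) height_wpow hW by simp
    have yz: "height N p y' + height N p z' = \<delta>" 
      unfolding hW[symmetric] jk(3) by simp
    \<comment> \<open>Within one copy of 10^a the cut is either at its left boundary or after its 1,
      where only zeros remain.\<close>
    have y': "height N p y' = 0 \<or> height N p z' \<le> 0 \<and> - height N p z' \<le> int a * p \<and> height N p y' \<le> N - p"
    proof (cases "y' = []")
      case False
      obtain i where i: "y' = ltr1 # replicate i ltr0" "z' = replicate (a - i) ltr0"
        by (rule one_zeros_eq_append[OF jk(3) False])
      have "0 \<le> int i * p" "0 \<le> int (a - i) * p" "int (a - i) * p \<le> int a * p"
        using p(1) by (simp_all add: mult_right_mono del: of_nat_diff)
      moreover have "height N p y' = N - p - int i * p" "height N p z' = - int (a - i) * p"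
        by (simp_all add: i)
      ultimately show ?thesis by linarith
    qed simp
    show ?thesis
    proof (cases "\<delta> \<ge> 0")
      case True
      then have jk: "0 \<le> int j * \<delta>" "0 \<le> int k * \<delta>" by auto
      have "int a * p \<le> N - p" using True unfolding \<delta>_def by linarith
      then have "- height N p z \<le> N - p" "- p \<le> height N p y"
        using y' hy hz yz jk p True by (elim disjE conjE; linarith)+
      then show ?thesis by blast
    next
      case False
      then have jk: "int j * \<delta> \<le> 0" "int k * \<delta> \<le> 0" by (auto simp: mult_le_0_iff)
      then have "height N p y \<le> N - p" "- p \<le> - height N p z"
        using y' hy hz yz p False by (elim disjE conjE; linarith)+
      then show ?thesis by blast
    qed
  qed
  moreover have "?goal [] z" "?goal y []" using p by simp_all
  ultimately show "?goal y z" by (cases "y = []"; cases "z = []") simp_all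
qed

lemma tame_S_words:
  assumes "0 \<le> p" "p \<le> N" "X \<in> S_words a b"
  shows "tame N p X"
proof -
  have one: "[ltr1] @ wpow [ltr0] k = ltr1 # replicate k ltr0" for k
    by (simp add: wpow_eq_replicate)
  have "tame N p S1"
    unfolding tame_def
  proof (intro allI impI)
    fix y z assume "S1 = y @ z"
    then have "y = [] \<or> z = []" unfolding S1_def by (cases y) auto
    then show "(height N p y \<le> N - p \<or> - height N p z \<le> N - p) \<and>
      (- p \<le> height N p y \<or> - p \<le> - height N p z)"
      using assms(1,2) by auto
  qed
  moreover have "tame N p (S2 a)" "tame N p (S3 a)" "tame N p (S4 a)"
    using tame_zero_one_zeros[OF assms(1,2), of "a - 1"] tame_zero_one_zeros[OF assms(1,2), of a]
      tame_one_zeros[OF assms(1,2), of a]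
    by (simp_all add: S2_def S3_def S4_def wpow_eq_replicate)
  moreover have "tame N p (S5 a b)" "tame N p (S6 a b)"
    using tame_long[OF assms(1,2), of a b] tame_long[OF assms(1,2), of a "b + 1"]
    unfolding S5_def S6_def one by (simp_all add: wpow_eq_replicate)
  ultimately show ?thesis
    using assms(3) unfolding S_words_def by (elim insertE emptyE) simp_all
qed

text \<open>Only prefixes are constrained, unlike in the usual balance of factors. Heights at a
  given position are congruent modulo \<open>N\<close> and the interval has length \<open>N\<close>,
  so the height is determined unless it is one of the two extremes.\<close>

definition balanced :: "word \<Rightarrow> bool" where
  "balanced v \<longleftrightarrow> (\<forall>w. prefix w v \<longrightarrow>
     (let N = int (length v); p = int (count_list v ltr1)
      in - p \<le> height N p w \<and> height N p w \<le> N - p))"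

lemma balanced_if_solution_with:
  assumes "solution_with a b v"
  shows "balanced v"
proof -
  define N p where "N = int (length v)" and "p = int (count_list v ltr1)"
  obtain Xs where Xs: "set Xs \<subseteq> S_words a b" "concat Xs = v" "concat (map (\<lambda>X. X @ X) Xs) = v @ v"
    using assms by (auto simp: solution_with_def)
  have p: "0 \<le> p" "p \<le> N" using count_list_le_length[of v] by (auto simp: N_def p_def)
  have hv: "height N p v = 0" by (simp add: height_def N_def p_def)
  have tame: "height N p y \<le> N - p \<or> - height N p z \<le> N - p"
    "- height N p y \<le> p \<or> - (- height N p z) \<le> p" if "X \<in> set Xs" "X = y @ z" for X y z
  proof -
    have "tame N p X" using tame_S_words[OF p] Xs(1) that(1) by blast
    then show "height N p y \<le> N - p \<or> - height N p z \<le> N - p"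
      "- height N p y \<le> p \<or> - (- height N p z) \<le> p"
      using that(2) unfolding tame_def by force+
  qed
  have "height N p w \<le> N - p \<and> - height N p w \<le> p" if "prefix w v" for w
  proof
    show "height N p w \<le> N - p"
      by (rule height_bounded_if_squares[where h = "height N p", OF Xs(3,2)])
        (use p hv tame(1) that in simp_all)
    \<comment> \<open>The lower bound is the upper bound for the negated height.\<close>
    show "- height N p w \<le> p"
      by (rule height_bounded_if_squares[where h = "\<lambda>w. - height N p w", OF Xs(3,2)])
        (use p hv tame(2) that in simp_all)
  qed
  then show ?thesis unfolding balanced_def Let_def N_def[symmetric] p_def[symmetric]
    by (simp add: minus_le_iff)
qed

section \<open>Reversed standard words are balanced\<close>

text \<open>The exchange replaces p by N - p and reflects the path, which reflects the interval of
  allowed heights too.\<close>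

lemma balanced_Not:
  assumes "balanced v"
  shows "balanced (map Not v)"
  unfolding balanced_def Let_def
proof (intro allI impI)
  fix w assume "prefix w (map Not v)"
  then have w: "prefix (map Not w) v"
    using map_mono_prefix[of w "map Not v" Not] by (simp add: comp_def)
  let ?N = "int (length v)" and ?p = "int (count_list v ltr1)"
  have c: "count_list u ltr1 \<le> length u" for u by (rule count_list_le_length)
  have "height ?N (?N - ?p) w = - height ?N ?p (map Not w)"
    using c[of w] by (simp add: height_def count_list_map_Not algebra_simps)
  moreover have "- ?p \<le> height ?N ?p (map Not w)" "height ?N ?p (map Not w) \<le> ?N - ?p"
    using assms w by (auto simp: balanced_def Let_def)
  ultimately show "- int (count_list (map Not v) ltr1)
      \<le> height (int (length (map Not v))) (int (count_list (map Not v) ltr1)) w \<and>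
    height (int (length (map Not v))) (int (count_list (map Not v) ltr1)) w
      \<le> int (length (map Not v)) - int (count_list (map Not v) ltr1)"
    using c[of v] by (simp add: count_list_map_Not)
qed

lemma prefix_phi_cases:
  assumes "prefix w (phi v)"
  obtains u where "prefix u v" "w = phi u" | u where "prefix (u @ [ltr1]) v" "w = phi u @ [ltr1]"
  using assms
proof (induction v arbitrary: w thesis)
  case Nil
  then show ?case by simp
next
  case (Cons c v)
  have "w = [] \<or> (c \<and> w = [ltr1]) \<or> (\<exists>w'. w = phi [c] @ w' \<and> prefix w' (phi v))"
    using Cons.prems(3) by (auto simp: prefix_Cons split: if_splits)
  then consider "w = []" | "c" "w = [ltr1]" | w' where "w = phi [c] @ w'" "prefix w' (phi v)"
    by blast
  then show ?case
  proof cases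
    case 1
    then show ?thesis using Cons.prems(1)[of "[]"] by simp
  next
    case 2
    then show ?thesis using Cons.prems(2)[of "[]"] by simp
  next
    case 3
    show ?thesis
    proof (rule Cons.IH[OF _ _ 3(2)])
      fix u assume "prefix u v" "w' = phi u"
      then show thesis using 3 Cons.prems(1)[of "c # u"] by simp
    next
      fix u assume "prefix (u @ [ltr1]) v" "w' = phi u @ [ltr1]"
      then show thesis using 3 Cons.prems(2)[of "c # u"] by simp
    qed
  qed
qed

text \<open>Heights of \<open>phi u\<close> for the new length \<open>N + p\<close> equal those of
  \<open>u\<close>. The only new prefixes, \<open>phi u\<close> followed by 1, lie \<open>p\<close>
  above the height of \<open>u @ [ltr1]\<close>, and the upper bound grows by \<open>p\<close> as
  well.\<close>

lemma balanced_phi: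
  assumes "balanced v"
  shows "balanced (phi v)"
  unfolding balanced_def Let_def
proof (intro allI impI)
  fix w assume w: "prefix w (phi v)"
  define N p where "N = int (length v)" and "p = int (count_list v ltr1)"
  have h: "height (N + p) p (phi u) = height N p u" for u
    by (simp add: height_def algebra_simps)
  have v: "- p \<le> height N p u \<and> height N p u \<le> N - p" if "prefix u v" for u
    using assms that by (auto simp: balanced_def N_def p_def Let_def)
  have p: "0 \<le> p" "p \<le> N" using count_list_le_length[of v] by (auto simp: N_def p_def)
  from w have "- p \<le> height (N + p) p w \<and> height (N + p) p w \<le> N"
  proof (cases rule: prefix_phi_cases)
    case (1 u)
    then show ?thesis using v[of u] h p by simp
  next
    case (2 u)
    then show ?thesis using v[of "u @ [ltr1]"] h[of u] p by auto
  qed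
  then show "- int (count_list (phi v) ltr1)
      \<le> height (int (length (phi v))) (int (count_list (phi v) ltr1)) w \<and>
    height (int (length (phi v))) (int (count_list (phi v) ltr1)) w
      \<le> int (length (phi v)) - int (count_list (phi v) ltr1)"
    by (simp add: N_def p_def)
qed

lemma balanced_if_rev_std: "rev_std v \<Longrightarrow> balanced v"
proof (induction rule: rev_std.induct)
  case zero
  have "w = [] \<or> w = [ltr0]" if "prefix w [ltr0]" for w
    using that by (cases w) auto
  then show ?case unfolding balanced_def Let_def by fastforce
qed (simp_all add: balanced_Not balanced_phi)

section \<open>Balanced words with coprime length and number of 1s\<close>

text \<open>
  If two such words differ in the number of 1s at position \<open>i\<close>, then their heights there are the
  two extremes \<open>- p\<close> and \<open>N - p\<close>. Since \<open>N\<close> and \<open>p\<close> are coprime, this happens for \<open>i = 1\<close> only.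
\<close>

lemma balanced_unique:
  assumes "balanced u" "balanced v" "length u = length v" "count_list u ltr1 = count_list v ltr1"
    and gcd: "gcd (length v) (count_list v ltr1) = 1" and hd: "hd u = hd v"
  shows "u = v"
proof -
  define N p where "N = int (length v)" and "p = int (count_list v ltr1)"
  have cop: "coprime N p"
    using gcd by (simp add: N_def p_def coprime_iff_gcd_eq_1)
  have eq: "count_list (take i u) ltr1 = count_list (take i v) ltr1" if i: "i \<le> length v" for i
  proof (rule ccontr)
    assume neq: "count_list (take i u) ltr1 \<noteq> count_list (take i v) ltr1"
    define c d where "c = int (count_list (take i u) ltr1)" and "d = int (count_list (take i v) ltr1)"
    have "- p \<le> height N p (take i u) \<and> height N p (take i u) \<le> N - p"
      using assms(1,3,4) take_is_prefix[of i u] unfolding balanced_def Let_def N_def p_def by metis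
    moreover have "- p \<le> height N p (take i v) \<and> height N p (take i v) \<le> N - p"
      using assms(2) take_is_prefix[of i v] unfolding balanced_def Let_def N_def p_def by metis
    ultimately have c: "- p \<le> N * c - p * int i" "N * c - p * int i \<le> N - p"
      and d: "- p \<le> N * d - p * int i" "N * d - p * int i \<le> N - p"
      using i assms(3) by (auto simp: height_def c_def d_def)
    have "take 1 u = take 1 v"
      using hd assms(3) by (cases u; cases v) auto
    then have "i \<noteq> 0" "i \<noteq> 1" using neq by (metis take0, metis)
    then have N: "N > 0" using i unfolding N_def by linarith
    \<comment> \<open>Different counts give heights at least \<open>N\<close> apart in an interval
      of length \<open>N\<close>, so the smaller count has height exactly
      \<open>- p\<close>.\<close>
    have "N * c = p * (int i - 1) \<or> N * d = p * (int i - 1)"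
    proof (cases "c < d")
      case True
      then have "N * (c + 1) \<le> N * d" using N by (intro mult_left_mono) auto
      then show ?thesis using c d by (simp add: algebra_simps)
    next
      case False
      then have "d + 1 \<le> c" using neq by (simp add: c_def d_def)
      then have "N * (d + 1) \<le> N * c" using N by (intro mult_left_mono) auto
      then show ?thesis using c d by (simp add: algebra_simps)
    qed
    then have "N dvd p * (int i - 1)" by (metis dvd_triv_left)
    then have "N dvd int i - 1" using cop by (simp add: coprime_dvd_mult_right_iff)
    then have "N \<le> int i - 1" using \<open>i \<noteq> 0\<close> \<open>i \<noteq> 1\<close> by (intro zdvd_imp_le) auto
    then show False using i by (simp add: N_def)
  qed
  show ?thesis
  proof (rule nth_equalityI)
    fix i assume i: "i < length u"
    then show "u ! i = v ! i"
      using eq[of i] eq[of "Suc i"] assms(3) by (auto simp: take_Suc_conv_app_nth split: if_splits)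
  qed (rule assms(3))
qed

text \<open>The subtractive Euclidean algorithm: for 2p < N a word of length N - p with p ones is
  lifted by \<open>phi\<close>, which keeps the first letter; for 2p > N the exchange reduces to N -
  p ones. The base 2p = N forces p = 1, with the words 10 and 01.\<close>

lemma ex_rev_std:
  assumes "coprime N p" "0 < p" "p < N"
  shows "\<exists>v. rev_std v \<and> length v = N \<and> count_list v ltr1 = p \<and> hd v = c"
  using assms
proof (induction N arbitrary: p c rule: less_induct)
  case (less N)
  \<comment> \<open>General in \<open>q\<close> and \<open>c\<close>, since the exchange calls it
    with \<open>N - p\<close> and the opposite first letter.\<close>
  have main: "\<exists>v. rev_std v \<and> length v = N \<and> count_list v ltr1 = q \<and> hd v = c"
    if q: "coprime N q" "0 < q" "2 * q \<le> N" for q c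
  proof (cases "2 * q = N")
    case True
    then have "q = 1" using q(1) by auto
    have one_zero: "rev_std [ltr1, ltr0]" using rev_std.phi[OF rev_std_one] by simp
    then have "rev_std [ltr0, ltr1]" using rev_std.map_Not by fastforce
    then show ?thesis using one_zero \<open>q = 1\<close> True
      by (cases c) (auto intro: exI[of _ "[ltr1, ltr0]"] exI[of _ "[ltr0, ltr1]"])
  next
    case False
    have lt: "q < N - q" "N - q < N" using q False by linarith+
    have "coprime (N - q) q" using q by (simp add: coprime_iff_gcd_eq_1 gcd_diff1_nat)
    then obtain v where v: "rev_std v" "length v = N - q" "count_list v ltr1 = q" "hd v = c"
      using less.IH[of "N - q" q c] lt q(2) by auto
    then have "hd (phi v) = c" using lt by (cases v rule: list.exhaust) auto
    then show ?thesis using v q by (intro exI[of _ "phi v"]) (auto intro: rev_std.phi)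
  qed
  show ?case
  proof (cases "2 * p \<le> N")
    case True
    then show ?thesis using main less.prems by blast
  next
    case False
    have np: "0 < N - p" "2 * (N - p) \<le> N" using False less.prems by linarith+
    have "coprime N (N - p)"
      using less.prems by (metis coprime_iff_gcd_eq_1 gcd_diff2_nat gcd.commute less_imp_le)
    with np obtain v where v: "rev_std v" "length v = N" "count_list v ltr1 = N - p" "hd v = (\<not> c)"
      using main[of "N - p" "\<not> c"] np by blast
    then have "hd (map Not v) = c" using less.prems by (cases v rule: list.exhaust) auto
    then show ?thesis using v less.prems
      by (intro exI[of _ "map Not v"]) (auto intro: rev_std.map_Not simp: count_list_map_Not)
  qed
qed

text \<open>The word is compared with the one from \<open>ex_rev_std\<close> of the same length,
  number of 1s and first letter. If all letters are equal, coprimality leaves a single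
  letter.\<close>

lemma rev_std_if_balanced:
  assumes "balanced v" "v \<noteq> []" and gcd: "gcd (length v) (count_list v ltr1) = 1"
  shows "rev_std v"
proof -
  define p where "p = count_list v ltr1"
  have "p \<le> length v" using count_list_le_length by (simp add: p_def)
  then consider "p = 0" | "p = length v" | "0 < p" "p < length v" by linarith
  then show ?thesis
  proof cases
    case 1
    then have "length v = 1" using gcd by (simp add: p_def)
    then obtain c where "v = [c]" by (auto simp: length_Suc_conv)
    then show ?thesis using rev_std.zero rev_std_one by (cases c) auto
  next
    case 2
    then have "length v = 1" using gcd by (simp add: p_def)
    then obtain c where "v = [c]" by (auto simp: length_Suc_conv)
    then show ?thesis using rev_std.zero rev_std_one by (cases c) auto
  next
    case 3
    then obtain u where u: "rev_std u" "length u = length v" "count_list u ltr1 = p" "hd u = hd v"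
      using ex_rev_std[of "length v" p "hd v"] gcd by (auto simp: coprime_iff_gcd_eq_1 p_def)
    then have "u = v"
      using balanced_unique[OF balanced_if_rev_std[OF u(1)] assms(1)] gcd by (simp add: p_def)
    then show ?thesis using u by simp
  qed
qed

section \<open>The characterization and passage to limits\<close>

lemma rev_std_iff_solution:
  "rev_std v \<longleftrightarrow> solution v \<and> gcd (length v) (count_list v ltr1) = 1"
proof
  assume "solution v \<and> gcd (length v) (count_list v ltr1) = 1"
  then obtain a b where gcd: "gcd (length v) (count_list v ltr1) = 1"
    and sol: "solution_with a b v \<or> solution_with a b (map Not v)"
    by (auto simp: solution_def)
  then have "v \<noteq> []" by (auto simp: solution_with_iff)
  have "balanced v \<or> balanced (map Not v)"
    using sol balanced_if_solution_with by blast
  then have "balanced v" using balanced_Not[of "map Not v"] by (auto simp: comp_def)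
  then show "rev_std v" by (rule rev_std_if_balanced) fact+
qed (simp add: solution_if_rev_std gcd_if_rev_std del: One_nat_def)

theorem theorem1p2:
  fixes x :: "nat \<Rightarrow> bool"
  shows "standard_sturmian x \<longleftrightarrow>
    (\<exists>w. (\<forall>n. solution (w n) \<and> gcd (length (w n)) (count_list (w n) ltr1) = 1) \<and>
         word_limit (\<lambda>n. rev (w n)) x)"
proof -
  have "standard_sturmian x \<longleftrightarrow> (\<exists>w. (\<forall>n. rev_std (w n)) \<and> word_limit (\<lambda>n. rev (w n)) x)"
  proof
    assume "standard_sturmian x"
    then obtain v where "\<forall>n. standard_word (v n)" "word_limit v x"
      by (auto simp: standard_sturmian_def)
    then show "\<exists>w. (\<forall>n. rev_std (w n)) \<and> word_limit (\<lambda>n. rev (w n)) x"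
      by (intro exI[of _ "\<lambda>n. rev (v n)"]) (simp add: standard_word_iff_rev_std)
  next
    assume "\<exists>w. (\<forall>n. rev_std (w n)) \<and> word_limit (\<lambda>n. rev (w n)) x"
    then obtain w where "\<forall>n. rev_std (w n)" "word_limit (\<lambda>n. rev (w n)) x" by blast
    then show "standard_sturmian x" unfolding standard_sturmian_def
      by (intro exI[of _ "\<lambda>n. rev (w n)"]) (simp add: standard_word_iff_rev_std)
  qed
  then show ?thesis
    by (simp only: rev_std_iff_solution)
qed

end
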